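(* Let $\mathrm{cat}(f)$ be the Lusternik–Schnirelmann category of a map $f:X\to Y$. Then $\mathrm{cat}:[X,Y]\to(\mathbb{Z}_{\geqq 0},\leqq)$, $\mathrm{cat}([f]):=\mathrm{cat}(f)$, is a monotone map. In the case of cat, we have three finer poset-stratified space structures on the reversed ordered posets $[X,Y]_R$, $[X,Y]_L$ and $[X,Y]_{LR}$, as follows. (1) If $[g]\leqq_R[f]$, i.e. $g\sim f\circ s$ with $s:X\to X$, then $\mathrm{cat}(g)=\mathrm{cat}(f\circ s)\leqq\min\{\mathrm{cat}(f),\mathrm{cat}(s)\}\leqq\mathrm{cat}(f)$. Hence $\mathrm{cat}(g)\leqq\mathrm{cat}(f)$, and thus there is a poset map $\mathrm{cat}_R:[X,Y]_R\to(\mathbb{Z}_{\geqq 0},\leqq)$, where $\mathrm{cat}_R([f]_R):=\mathrm{cat}(f)$. (2) If $[g]\leqq_L[f]$, i.e. $g\sim t\circ f$ with $t:Y\to Y$, then $\mathrm{cat}(g)=\mathrm{cat}(t\circ f)\leqq\min\{\mathrm{cat}(t),\mathrm{cat}(f)\}\leqq\mathrm{cat}(f)$. Hence $\mathrm{cat}(g)\leqq\mathrm{cat}(f)$, and thus $\mathrm{cat}_L:[X,Y]_L\to(\mathbb{Z}_{\geqq 0},\leqq)$ is a poset map, where $\mathrm{cat}_L([f]_L):=\mathrm{cat}(f)$. (3) If $[g]\leqq_{LR}[f]$, i.e. $g\sim t\circ f\circ s$ with $s:X\to X$ and $t:Y\to Y$, then $\mathrm{cat}(g)=\mathrm{cat}(t\circ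 f\circ s)\leqq\min\{\mathrm{cat}(t),\mathrm{cat}(f),\mathrm{cat}(s)\}\leqq\mathrm{cat}(f)$. Hence $\mathrm{cat}(g)\leqq\mathrm{cat}(f)$, and thus $\mathrm{cat}_{LR}:[X,Y]_{LR}\to(\mathbb{Z}_{\geqq 0},\leqq)$ is a poset map, where $\mathrm{cat}_{LR}([f]_{LR}):=\mathrm{cat}(f)$. Namely, $\mathrm{cat}_R\circ\pi_R=\mathrm{cat}$, $\mathrm{cat}_L\circ\pi_L=\mathrm{cat}$ and $\mathrm{cat}_{LR}\circ\pi_{LR}=\mathrm{cat}$ as maps $[X,Y]\to\mathbb{Z}_{\geqq 0}$.
   Context: $X$ and $Y$ are topological spaces, $\sim$ between maps denotes homotopy, and $[X,Y]$ is the set of homotopy classes of continuous maps $X\to Y$. The Lusternik–Schnirelmann category $\mathrm{cat}(f)$ of $f:X\to Y$ is the least integer $m\geqq 0$ such that $X$ is the union of $m+1$ open subsets $U_0,\dots,U_m$ with each restriction $f|_{U_i}:U_i\to Y$ homotopic to a constant map. Preorders on $[X,Y]$: $[g]\leqq_R[f]$ iff there is $[s]\in[X,X]$ with $[g]=[f]\circ[s]$; $[g]\leqq_L[f]$ iff there is $[t]\in[Y,Y]$ with $[g]=[t]\circ[f]$; $[g]\leqq_{LR}[f]$ iff there are $[s]\in[X,X]$ and $[t]\in[Y,Y]$ with $[g]=[t]\circ[f]\circ[s]$. For $\bullet\in\{R,L,LR\}$: $[f]\sim_\bullet[g]$ iff $[f]\leqq_\bullet[g]$ and $[g]\leqq_\bullet[f]$;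 $[X,Y]_\bullet=[X,Y]/\sim_\bullet$; $[f]_\bullet$ is the class of $[f]$; $\pi_\bullet:[X,Y]\to[X,Y]_\bullet$ is $\pi_\bullet([f])=[f]_\bullet$; and the partial order on $[X,Y]_\bullet$ is $[g]_\bullet\leqq'_\bullet[f]_\bullet$ iff $[g]\leqq_\bullet[f]$. The reversed order of an order $\leqq$ is given by $a\leqq^{op}b$ iff $b\leqq a$. A poset map is a monotone (order-preserving) map of posets. A poset-stratified space is a topological space $S$ with a continuous map $S\to P$ to a poset $P$, where $P$ carries the Alexandroff topology (open sets are the upward closed subsets); a monotone map from a preordered set to a poset is such a structure when the source also carries its Alexandroff topology.
   Formalization: The category cat(f) need not be finite (e.g. the identity of an infinite discrete space); it is set to ∞ when no finite cover exists, and the target is Z_{≥0} when all cat(f), f:X→Y, are finite, and Z_{≥0} together with ∞ otherwise. *)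

theory Defs
  imports "HOL-Analysis.Analysis"
begin

section \<open>Homotopy sets\<close>

abbreviation homotopic_maps :: "'a topology \<Rightarrow> 'b topology \<Rightarrow> ('a \<Rightarrow> 'b) \<Rightarrow> ('a \<Rightarrow> 'b) \<Rightarrow> bool"
  where "homotopic_maps \<equiv> homotopic_with (\<lambda>_. True)"

text \<open>Values outside the space \<open>X\<close> do not matter: \<^const>\<open>homotopic_with\<close> identifies any two
  functions that agree on \<open>topspace X\<close>.\<close>

definition homotopy_class :: "'a topology \<Rightarrow> 'b topology \<Rightarrow> ('a \<Rightarrow> 'b) \<Rightarrow> ('a \<Rightarrow> 'b) set"
  where "homotopy_class X Y f = {g. homotopic_maps X Y f g}"

definition homotopy_set :: "'a topology \<Rightarrow> 'b topology \<Rightarrow> ('a \<Rightarrow> 'b) set set"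
  where "homotopy_set X Y = homotopy_class X Y ` {f. continuous_map X Y f}"

definition class_comp ::
    "'a topology \<Rightarrow> 'c topology \<Rightarrow> ('b \<Rightarrow> 'c) set \<Rightarrow> ('a \<Rightarrow> 'b) set \<Rightarrow> ('a \<Rightarrow> 'c) set"
  where "class_comp X Z T F = (\<Union>t\<in>T. \<Union>f\<in>F. homotopy_class X Z (t \<circ> f))"

lemma homotopy_class_eq_iff:
  assumes "continuous_map X Y g"
  shows "homotopy_class X Y f = homotopy_class X Y g \<longleftrightarrow> homotopic_maps X Y f g"
proof
  have "g \<in> homotopy_class X Y g" using assms by (simp add: homotopy_class_def)
  moreover assume "homotopy_class X Y f = homotopy_class X Y g"
  ultimately have "g \<in> homotopy_class X Y f" by simp
  then show "homotopic_maps X Y f g" by (simp add: homotopy_class_def)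
next
  assume fg: "homotopic_maps X Y f g"
  have "homotopic_maps X Y f h \<longleftrightarrow> homotopic_maps X Y g h" for h
    using homotopic_with_trans[OF fg] homotopic_with_trans[OF homotopic_with_symD[OF fg]] by metis
  then show "homotopy_class X Y f = homotopy_class X Y g"
    by (simp add: homotopy_class_def)
qed

lemma class_comp_homotopy_class:
  assumes f: "continuous_map X Y f" and t: "continuous_map Y Z t"
  shows "class_comp X Z (homotopy_class Y Z t) (homotopy_class X Y f) = homotopy_class X Z (t \<circ> f)"
proof -
  have eq: "homotopy_class X Z (t' \<circ> f') = homotopy_class X Z (t \<circ> f)"
    if "t' \<in> homotopy_class Y Z t" "f' \<in> homotopy_class X Y f" for t' f'
  proof -
    have t': "homotopic_maps Y Z t t'" and f': "homotopic_maps X Y f f'"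
      using that by (simp_all add: homotopy_class_def)
    have "homotopic_maps X Z (t \<circ> f) (t' \<circ> f')"
      by (rule homotopic_compose[OF f' t'])
    then have "homotopic_maps X Z (t' \<circ> f') (t \<circ> f)"
      by (rule homotopic_with_symD)
    then show ?thesis
      using homotopy_class_eq_iff[OF continuous_map_compose[OF f t]] by simp
  qed
  have "t \<in> homotopy_class Y Z t" "f \<in> homotopy_class X Y f"
    using f t by (simp_all add: homotopy_class_def)
  then show ?thesis
    unfolding class_comp_def using eq by fast
qed

section \<open>The preorders on homotopy sets\<close>

text \<open>A pair \<open>(G, F)\<close> in one of these relations means that \<open>G\<close> is below \<open>F\<close>.\<close>

definition le_R :: "'a topology \<Rightarrow> 'b topology \<Rightarrow> ('a \<Rightarrow> 'b) set rel"
  where "le_R X Y = {(G, F). G \<in> homotopy_set X Y \<and> F \<in> homotopy_set X Y \<and>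
    (\<exists>S\<in>homotopy_set X X. G = class_comp X Y F S)}"

definition le_L :: "'a topology \<Rightarrow> 'b topology \<Rightarrow> ('a \<Rightarrow> 'b) set rel"
  where "le_L X Y = {(G, F). G \<in> homotopy_set X Y \<and> F \<in> homotopy_set X Y \<and>
    (\<exists>T\<in>homotopy_set Y Y. G = class_comp X Y T F)}"

definition le_LR :: "'a topology \<Rightarrow> 'b topology \<Rightarrow> ('a \<Rightarrow> 'b) set rel"
  where "le_LR X Y = {(G, F). G \<in> homotopy_set X Y \<and> F \<in> homotopy_set X Y \<and>
    (\<exists>S\<in>homotopy_set X X. \<exists>T\<in>homotopy_set Y Y. G = class_comp X Y (class_comp X Y T F) S)}"

section \<open>Poset reflection of a preorder\<close>

definition equiv_of :: "'x rel \<Rightarrow> 'x rel"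
  where "equiv_of r = r \<inter> r\<inverse>"

definition quot_class :: "'x rel \<Rightarrow> 'x \<Rightarrow> 'x set"
  where "quot_class r x = equiv_of r `` {x}"

definition quot_order :: "'x set \<Rightarrow> 'x rel \<Rightarrow> 'x set rel"
  where "quot_order A r = {(C, D). C \<in> A // equiv_of r \<and> D \<in> A // equiv_of r \<and>
    (\<exists>x\<in>C. \<exists>y\<in>D. (x, y) \<in> r)}"

lemma equiv_equiv_of:
  assumes "preorder_on A r"
  shows "equiv A (equiv_of r)"
proof (rule equivI)
  show "equiv_of r \<subseteq> A \<times> A" "refl_on A (equiv_of r)"
    using assms by (auto simp: preorder_on_def equiv_of_def refl_on_def)
  show "sym (equiv_of r)"
    by (auto simp: equiv_of_def sym_def)
  show "trans (equiv_of r)"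
    using assms by (simp add: preorder_on_def equiv_of_def trans_Int)
qed

lemma quot_order_class_iff:
  assumes "preorder_on A r" "x \<in> A" "y \<in> A"
  shows "(quot_class r x, quot_class r y) \<in> quot_order A r \<longleftrightarrow> (x, y) \<in> r"
proof -
  have xx: "(x, x) \<in> r" and yy: "(y, y) \<in> r" and tr: "trans r"
    using assms by (auto simp: preorder_on_def refl_on_def)
  have Q: "quot_class r x \<in> A // equiv_of r" "quot_class r y \<in> A // equiv_of r"
    unfolding quot_class_def using assms(2,3) by (simp_all add: quotientI)
  have mem: "u \<in> quot_class r v \<longleftrightarrow> (v, u) \<in> r \<and> (u, v) \<in> r" for u v
    by (simp add: quot_class_def equiv_of_def)
  show ?thesis
  proof
    assume "(quot_class r x, quot_class r y) \<in> quot_order A r"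
    then obtain u v where "u \<in> quot_class r x" "v \<in> quot_class r y" "(u, v) \<in> r"
      unfolding quot_order_def by blast
    then have "(x, u) \<in> r" "(u, v) \<in> r" "(v, y) \<in> r"
      by (simp_all add: mem)
    then show "(x, y) \<in> r" by (meson tr transD)
  next
    assume xy: "(x, y) \<in> r"
    have "x \<in> quot_class r x" "y \<in> quot_class r y"
      using xx yy by (simp_all add: mem)
    then show "(quot_class r x, quot_class r y) \<in> quot_order A r"
      unfolding quot_order_def using Q xy by blast
  qed
qed

section \<open>Poset-stratified spaces\<close>

definition order_preserving :: "'x set \<Rightarrow> 'x rel \<Rightarrow> 'y set \<Rightarrow> 'y rel \<Rightarrow> ('x \<Rightarrow> 'y) \<Rightarrow> bool"
  where "order_preserving A r B s h \<longleftrightarrow>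
    h \<in> A \<rightarrow> B \<and> monotone_on A (\<lambda>x y. (x, y) \<in> r) (\<lambda>x y. (x, y) \<in> s) h"

definition poset_map :: "'x set \<Rightarrow> 'x rel \<Rightarrow> 'y set \<Rightarrow> 'y rel \<Rightarrow> ('x \<Rightarrow> 'y) \<Rightarrow> bool"
  where "poset_map A r B s h \<longleftrightarrow>
    partial_order_on A r \<and> partial_order_on B s \<and> order_preserving A r B s h"

definition alexandroff :: "'x set \<Rightarrow> 'x rel \<Rightarrow> 'x topology"
  where "alexandroff A r =
    topology (\<lambda>U. U \<subseteq> A \<and> (\<forall>x\<in>U. \<forall>y\<in>A. (x, y) \<in> r \<longrightarrow> y \<in> U))"

lemma openin_alexandroff:
  "openin (alexandroff A r) U \<longleftrightarrow> U \<subseteq> A \<and> (\<forall>x\<in>U. \<forall>y\<in>A. (x, y) \<in> r \<longrightarrow> y \<in> U)"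
proof -
  have "istopology (\<lambda>U. U \<subseteq> A \<and> (\<forall>x\<in>U. \<forall>y\<in>A. (x, y) \<in> r \<longrightarrow> y \<in> U))"
    unfolding istopology_def by blast
  then show ?thesis by (simp add: alexandroff_def)
qed

lemma topspace_alexandroff [simp]: "topspace (alexandroff A r) = A"
  unfolding topspace_def openin_alexandroff by blast

definition poset_stratified :: "'s topology \<Rightarrow> 'x set \<Rightarrow> 'x rel \<Rightarrow> ('s \<Rightarrow> 'x) \<Rightarrow> bool"
  where "poset_stratified S P r p \<longleftrightarrow> partial_order_on P r \<and> continuous_map S (alexandroff P r) p"

text \<open>The stratification \<open>p\<close> is finer than \<open>q\<close>: \<open>q\<close> factors through \<open>p\<close> by a poset map \<open>h\<close>.\<close>

definition finer_stratification ::
    "'s topology \<Rightarrow> 'x set \<Rightarrow> 'x rel \<Rightarrow> ('s \<Rightarrow> 'x) \<Rightarrow> 'y set \<Rightarrow> 'y rel \<Rightarrow> ('s \<Rightarrow> 'y) \<Rightarrow> ('x \<Rightarrow> 'y) \<Rightarrow> bool"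
  where "finer_stratification S P r p Q s q h \<longleftrightarrow>
    poset_stratified S P r p \<and> poset_stratified S Q s q \<and>
    poset_map P r Q s h \<and> (\<forall>x\<in>topspace S. (h \<circ> p) x = q x)"

section \<open>Lusternik--Schnirelmann category of a map\<close>

text \<open>The pieces \<open>U i\<close> may be empty or repeated. The constant \<open>c\<close> lies in \<open>topspace Y\<close>
  automatically unless \<open>U i\<close> is empty.\<close>

definition cat_cover :: "'a topology \<Rightarrow> 'b topology \<Rightarrow> ('a \<Rightarrow> 'b) \<Rightarrow> nat \<Rightarrow> bool"
  where "cat_cover X Y f m \<longleftrightarrow> (\<exists>U :: nat \<Rightarrow> 'a set.
    topspace X = (\<Union>i\<le>m. U i) \<and>
    (\<forall>i\<le>m. openin X (U i) \<and> (\<exists>c. homotopic_maps (subtopology X (U i)) Y f (\<lambda>_. c))))"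

text \<open>The value is \<open>\<infinity>\<close> (the infimum of the empty set) if there is no such finite cover.\<close>

definition ls_cat :: "'a topology \<Rightarrow> 'b topology \<Rightarrow> ('a \<Rightarrow> 'b) \<Rightarrow> enat"
  where "ls_cat X Y f = Inf (enat ` {m. cat_cover X Y f m})"

text \<open>For functions on quotient sets, \<open>the_elem (h ` C)\<close> is the common value of \<open>h\<close> on the
  class \<open>C\<close>. The function \<open>cat_quot\<close> serves for all three quotients of the homotopy set.\<close>

definition cat_class :: "'a topology \<Rightarrow> 'b topology \<Rightarrow> ('a \<Rightarrow> 'b) set \<Rightarrow> enat"
  where "cat_class X Y F = the_elem (ls_cat X Y ` F)"

definition cat_quot :: "'a topology \<Rightarrow> 'b topology \<Rightarrow> ('a \<Rightarrow> 'b) set set \<Rightarrow> enat"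
  where "cat_quot X Y C = the_elem (cat_class X Y ` C)"

text \<open>The target of the category function: the nonnegative integers, with \<open>\<infinity>\<close> adjoined only
  if some map from \<open>X\<close> to \<open>Y\<close> has no finite categorical cover.\<close>

definition cat_values :: "'a topology \<Rightarrow> 'b topology \<Rightarrow> enat set"
  where "cat_values X Y =
    (if \<forall>f. continuous_map X Y f \<longrightarrow> ls_cat X Y f \<noteq> \<infinity> then range enat else UNIV)"

definition le_on :: "'x::order set \<Rightarrow> 'x rel"
  where "le_on A = {(m, n). m \<in> A \<and> n \<in> A \<and> m \<le> n}"

end

theory Submission
  imports Defs
begin

text \<open>A finite cover witnessing \<open>cat f \<le> m\<close> can be transported along compositions. If \<open>f\<close> is
  homotopic to a constant on each \<open>U\<^sub>i\<close>, then so is \<open>t \<circ> f\<close>; if \<open>t\<close> is homotopic to a constant on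
  each \<open>V\<^sub>i\<close>, then \<open>t \<circ> f\<close> is so on the open sets \<open>f\<^sup>-\<^sup>1 V\<^sub>i\<close>. Hence \<open>cat (t \<circ> f)\<close> is bounded by
  both \<open>cat t\<close> and \<open>cat f\<close> (\<open>ls_cat_compose_le\<close>), and since homotopies restrict to subspaces,
  \<open>cat\<close> depends only on the homotopy class (\<open>ls_cat_homotopic\<close>). So \<open>cat\<close> is monotone for each of
  the three preorders on the homotopy set (\<open>cat_class_mono\<close>).

  The rest holds for any monotone map \<open>h\<close> from a preorder to a poset. By antisymmetry of the
  target, \<open>h\<close> is constant on the classes of the poset reflection, so it descends to a poset map
  (\<open>the_elem_quot_class\<close>, \<open>poset_map_quot\<close>). Monotone maps are continuous for Alexandroff
  topologies, so the projection and the descended map form a finer stratification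
  (\<open>finer_stratification_quot\<close>). Forming the poset reflection commutes with reversing the order,
  so the reversed orders need no separate argument.\<close>

section \<open>Poset reflections and Alexandroff topologies\<close>

lemma equiv_of_converse [simp]: "equiv_of (r\<inverse>) = equiv_of r"
  by (auto simp: equiv_of_def)

lemma quot_class_converse [simp]: "quot_class (r\<inverse>) = quot_class r"
  by (rule ext) (simp add: quot_class_def)

lemma quot_order_converse: "quot_order A (r\<inverse>) = (quot_order A r)\<inverse>"
proof -
  have "(C, D) \<in> quot_order A (r\<inverse>) \<longleftrightarrow> (C, D) \<in> (quot_order A r)\<inverse>" for C D
    unfolding quot_order_def equiv_of_converse converse_iff mem_Collect_eq case_prod_conv by blast
  then show ?thesis by (intro set_eqI) (metis surj_pair)
qed

lemma order_preserving_converse: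
  "order_preserving A r B s h \<Longrightarrow> order_preserving A (r\<inverse>) B (s\<inverse>) h"
  by (auto simp: order_preserving_def monotone_on_def)

lemma quotient_equiv_of: "A // equiv_of r = quot_class r ` A"
  by (auto simp: quotient_def quot_class_def)

lemma quot_class_eqI:
  assumes "preorder_on A r" "(x, y) \<in> r" "(y, x) \<in> r"
  shows "quot_class r x = quot_class r y"
  unfolding quot_class_def
  by (rule equiv_class_eq[OF equiv_equiv_of[OF assms(1)]])
    (use assms(2,3) in \<open>simp add: equiv_of_def\<close>)

lemma partial_order_on_quot_order:
  assumes r: "preorder_on A r"
  shows "partial_order_on (A // equiv_of r) (quot_order A r)"
proof -
  note iff = quot_order_class_iff[OF r]
  have refl: "(x, x) \<in> r" if "x \<in> A" for x
    using r that by (auto simp: preorder_on_def refl_on_def)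
  have tr: "trans r" using r by (simp add: preorder_on_def)
  have sub: "quot_order A r \<subseteq> (A // equiv_of r) \<times> (A // equiv_of r)"
    by (auto simp: quot_order_def)
  have reps: "\<exists>x\<in>A. \<exists>y\<in>A. C = quot_class r x \<and> D = quot_class r y"
    if "(C, D) \<in> quot_order A r" for C D
    using that unfolding quot_order_def quotient_equiv_of by blast
  have "refl_on (A // equiv_of r) (quot_order A r)"
    by (auto simp: refl_on_def quotient_equiv_of iff refl)
  moreover have "trans (quot_order A r)"
  proof (rule transI)
    fix C D E assume CD: "(C, D) \<in> quot_order A r" and DE: "(D, E) \<in> quot_order A r"
    then obtain x y z where mem: "x \<in> A" "y \<in> A" "z \<in> A"
      and eq: "C = quot_class r x" "D = quot_class r y" "E = quot_class r z"
      using reps by metis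
    then have "(x, y) \<in> r" "(y, z) \<in> r" using CD DE by (auto simp: iff)
    then have "(x, z) \<in> r" by (rule transD[OF tr])
    then show "(C, E) \<in> quot_order A r" using mem by (simp add: eq iff)
  qed
  moreover have "antisym (quot_order A r)"
  proof (rule antisymI)
    fix C D assume CD: "(C, D) \<in> quot_order A r" and DC: "(D, C) \<in> quot_order A r"
    then obtain x y where mem: "x \<in> A" "y \<in> A"
      and eq: "C = quot_class r x" "D = quot_class r y"
      using reps by blast
    then have "(x, y) \<in> r" "(y, x) \<in> r" using CD DC by (auto simp: iff)
    then show "C = D" unfolding eq by (rule quot_class_eqI[OF r])
  qed
  ultimately show ?thesis
    using sub by (simp add: partial_order_on_def preorder_on_def)
qed

text \<open>The elements of a class lie below each other, so antisymmetry of the target forces \<open>h\<close> to be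
  constant on it; this makes the function that \<open>h\<close> induces on the quotient well defined.\<close>

lemma the_elem_quot_class:
  assumes r: "preorder_on A r" and s: "antisym s" and h: "order_preserving A r B s h"
    and x: "x \<in> A"
  shows "the_elem (h ` quot_class r x) = h x"
proof -
  have sub: "r \<subseteq> A \<times> A" and "(x, x) \<in> r"
    using r x by (auto simp: preorder_on_def refl_on_def)
  then have "x \<in> quot_class r x" by (simp add: quot_class_def equiv_of_def)
  moreover have "h y = h x" if "y \<in> quot_class r x" for y
  proof -
    have "(x, y) \<in> r" "(y, x) \<in> r" using that by (auto simp: quot_class_def equiv_of_def)
    moreover from this have "y \<in> A" using sub by auto
    ultimately have "(h x, h y) \<in> s" "(h y, h x) \<in> s"
      using h x by (auto simp: order_preserving_def monotone_on_def)
    then show ?thesis using s by (auto dest: antisymD)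
  qed
  ultimately have "h ` quot_class r x = {h x}" by blast
  then show ?thesis by simp
qed

lemma poset_map_quot:
  assumes r: "preorder_on A r" and s: "partial_order_on B s" and h: "order_preserving A r B s h"
  shows "poset_map (A // equiv_of r) (quot_order A r) B s (\<lambda>C. the_elem (h ` C))"
proof -
  have "antisym s" using s by (simp add: partial_order_on_def)
  note val = the_elem_quot_class[OF r this h]
  have "order_preserving (A // equiv_of r) (quot_order A r) B s (\<lambda>C. the_elem (h ` C))"
    using h by (auto simp: order_preserving_def monotone_on_def quotient_equiv_of val
        quot_order_class_iff[OF r])
  then show ?thesis
    using partial_order_on_quot_order[OF r] s by (simp add: poset_map_def)
qed

lemma order_preserving_quot_class:
  assumes "preorder_on A r"
  shows "order_preserving A r (A // equiv_of r) (quot_order A r) (quot_class r)"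
  by (auto simp: order_preserving_def monotone_on_def quotient_equiv_of
      quot_order_class_iff[OF assms])

text \<open>Preimages of upward closed sets under a monotone map are upward closed.\<close>

lemma continuous_map_alexandroff:
  assumes "order_preserving A r B s h"
  shows "continuous_map (alexandroff A r) (alexandroff B s) h"
  unfolding continuous_map_def openin_alexandroff topspace_alexandroff
proof (intro conjI allI impI)
  show "h \<in> A \<rightarrow> B" using assms by (simp add: order_preserving_def)
next
  fix U assume "U \<subseteq> B \<and> (\<forall>x\<in>U. \<forall>y\<in>B. (x, y) \<in> s \<longrightarrow> y \<in> U)"
  moreover have "h y \<in> B" "(h x, h y) \<in> s" if "x \<in> A" "y \<in> A" "(x, y) \<in> r" for x y
    using assms that by (auto simp: order_preserving_def monotone_on_def)
  ultimately show "\<forall>x\<in>{x \<in> A. h x \<in> U}. \<forall>y\<in>A. (x, y) \<in> r \<longrightarrow> y \<in> {x \<in> A. h x \<in> U}"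
    by blast
qed blast

lemma poset_stratified_alexandroff:
  assumes "order_preserving A r B s h" "partial_order_on B s"
  shows "poset_stratified (alexandroff A r) B s h"
  using assms by (simp add: poset_stratified_def continuous_map_alexandroff)

lemma finer_stratification_quot:
  assumes r: "preorder_on A r" and s: "partial_order_on B s" and h: "order_preserving A r B s h"
  shows "finer_stratification (alexandroff A r) (A // equiv_of r) (quot_order A r) (quot_class r)
    B s h (\<lambda>C. the_elem (h ` C))"
proof -
  have "antisym s" using s by (simp add: partial_order_on_def)
  then show ?thesis
    using poset_map_quot[OF assms] the_elem_quot_class[OF r _ h]
      poset_stratified_alexandroff[OF h s]
      poset_stratified_alexandroff[OF order_preserving_quot_class[OF r]
        partial_order_on_quot_order[OF r]]
    by (simp add: finer_stratification_def)
qed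

lemma partial_order_on_le_on: "partial_order_on B (le_on B)"
  by (auto simp: partial_order_on_def preorder_on_def refl_on_def le_on_def trans_def antisym_def)

section \<open>Category of composites and homotopy invariance\<close>

text \<open>The same cover serves for \<open>g\<close>: the homotopy from \<open>f\<close> to \<open>g\<close> restricts to each piece, where
  it can be concatenated with the homotopy from \<open>f\<close> to a constant.\<close>

lemma cat_cover_homotopic:
  assumes fg: "homotopic_maps X Y f g" and "cat_cover X Y f m"
  shows "cat_cover X Y g m"
proof -
  have "homotopic_maps (subtopology X U) Y g (\<lambda>_. c)"
    if "homotopic_maps (subtopology X U) Y f (\<lambda>_. c)" for U c
  proof -
    \<comment> \<open>Restriction of a homotopy is composition with the inclusion of the subspace.\<close>
    have "homotopic_maps (subtopology X U) Y (f \<circ> id) (g \<circ> id)"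
      by (rule homotopic_with_compose_continuous_map_right[OF fg])
        (simp_all add: continuous_map_from_subtopology)
    then show ?thesis
      using that by (metis comp_id homotopic_with_symD homotopic_with_trans)
  qed
  then show ?thesis using assms(2) unfolding cat_cover_def by meson
qed

lemma cat_cover_compose_left:
  assumes t: "continuous_map Y Z t" and "cat_cover X Y f m"
  shows "cat_cover X Z (t \<circ> f) m"
proof -
  have "homotopic_maps (subtopology X U) Z (t \<circ> f) (\<lambda>_. t c)"
    if "homotopic_maps (subtopology X U) Y f (\<lambda>_. c)" for U c
    using homotopic_with_compose_continuous_map_left[OF that t, of "\<lambda>_. True"]
    by (simp add: o_def)
  then show ?thesis using assms(2) unfolding cat_cover_def by meson
qed

text \<open>The cover of \<open>X\<close> consists of the preimages under \<open>f\<close> of the pieces that cover \<open>Y\<close>.\<close>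

lemma cat_cover_compose_right:
  assumes f: "continuous_map X Y f" and "cat_cover Y Z t m"
  shows "cat_cover X Z (t \<circ> f) m"
proof -
  obtain V where "topspace Y = (\<Union>i\<le>m. V i) \<and> (\<forall>i\<le>m. openin Y (V i) \<and>
      (\<exists>c. homotopic_maps (subtopology Y (V i)) Z t (\<lambda>_. c)))"
    using assms(2) unfolding cat_cover_def by (rule exE)
  then have V: "topspace Y = (\<Union>i\<le>m. V i)"
    and op: "\<And>i. i \<le> m \<Longrightarrow> openin Y (V i)"
    and ho: "\<And>i. i \<le> m \<Longrightarrow> \<exists>c. homotopic_maps (subtopology Y (V i)) Z t (\<lambda>_. c)"
    by simp_all
  define U where "U i = {x \<in> topspace X. f x \<in> V i}" for i
  have cover: "topspace X = (\<Union>i\<le>m. U i)"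
    using V f by (auto simp: U_def continuous_map_def)
  have "openin X (U i)" if "i \<le> m" for i
    unfolding U_def by (rule openin_continuous_map_preimage[OF f op[OF that]])
  moreover have "\<exists>c. homotopic_maps (subtopology X (U i)) Z (t \<circ> f) (\<lambda>_. c)" if i: "i \<le> m" for i
  proof -
    obtain c where "homotopic_maps (subtopology Y (V i)) Z t (\<lambda>_. c)"
      using ho[OF i] by blast
    moreover have "continuous_map (subtopology X (U i)) (subtopology Y (V i)) f"
      using f by (auto simp: continuous_map_in_subtopology continuous_map_from_subtopology U_def)
    ultimately have "homotopic_maps (subtopology X (U i)) Z (t \<circ> f) ((\<lambda>_. c) \<circ> f)"
      by (rule homotopic_with_compose_continuous_map_right) auto
    then show ?thesis by (auto simp: o_def)
  qed
  ultimately show ?thesis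
    unfolding cat_cover_def by (intro exI[of _ U] conjI allI impI cover)
qed

lemma ls_cat_mono:
  assumes "\<And>m. cat_cover X Y f m \<Longrightarrow> cat_cover X' Y' g m"
  shows "ls_cat X' Y' g \<le> ls_cat X Y f"
  unfolding ls_cat_def using assms by (intro Inf_superset_mono image_mono) auto

lemma ls_cat_homotopic:
  assumes "homotopic_maps X Y f g"
  shows "ls_cat X Y f = ls_cat X Y g"
  using cat_cover_homotopic[OF assms] cat_cover_homotopic[OF homotopic_with_symD[OF assms]]
  by (intro order_antisym ls_cat_mono)

lemma ls_cat_compose_le:
  assumes "continuous_map X Y f" "continuous_map Y Z t"
  shows "ls_cat X Z (t \<circ> f) \<le> ls_cat X Y f" "ls_cat X Z (t \<circ> f) \<le> ls_cat Y Z t"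
  using assms by (auto intro: ls_cat_mono cat_cover_compose_left cat_cover_compose_right)

lemma cat_class_homotopy_class:
  assumes "continuous_map X Y f"
  shows "cat_class X Y (homotopy_class X Y f) = ls_cat X Y f"
proof -
  have "f \<in> homotopy_class X Y f" using assms by (simp add: homotopy_class_def)
  moreover have "ls_cat X Y g = ls_cat X Y f" if "g \<in> homotopy_class X Y f" for g
    using that ls_cat_homotopic[of X Y f g] by (simp add: homotopy_class_def)
  ultimately have "ls_cat X Y ` homotopy_class X Y f = {ls_cat X Y f}" by blast
  then show ?thesis by (simp add: cat_class_def)
qed

section \<open>The three preorders on homotopy sets\<close>

lemma homotopy_class_in_homotopy_set:
  "continuous_map X Y f \<Longrightarrow> homotopy_class X Y f \<in> homotopy_set X Y"
  by (simp add: homotopy_set_def)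

lemma homotopy_setE:
  assumes "F \<in> homotopy_set X Y"
  obtains f where "continuous_map X Y f" "F = homotopy_class X Y f"
  using assms by (auto simp: homotopy_set_def)

text \<open>Composition of classes is computed on representatives, so each preorder relates two classes
  exactly if representatives are related up to homotopy. This reduces reflexivity and transitivity
  below to composing maps and homotopies.\<close>

context
  fixes X :: "'a topology" and Y :: "'b topology" and f g :: "'a \<Rightarrow> 'b"
  assumes f: "continuous_map X Y f" and g: "continuous_map X Y g"
begin

lemma le_R_iff:
  "(homotopy_class X Y g, homotopy_class X Y f) \<in> le_R X Y \<longleftrightarrow>
    (\<exists>s. continuous_map X X s \<and> homotopic_maps X Y g (f \<circ> s))"
proof -
  have "homotopy_class X Y g = class_comp X Y (homotopy_class X Y f) (homotopy_class X X s) \<longleftrightarrow>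
      homotopic_maps X Y g (f \<circ> s)" if "continuous_map X X s" for s
    using class_comp_homotopy_class[OF that f]
      homotopy_class_eq_iff[OF continuous_map_compose[OF that f]] by simp
  then show ?thesis
    using f g by (auto simp: le_R_def homotopy_set_def)
qed

lemma le_L_iff:
  "(homotopy_class X Y g, homotopy_class X Y f) \<in> le_L X Y \<longleftrightarrow>
    (\<exists>t. continuous_map Y Y t \<and> homotopic_maps X Y g (t \<circ> f))"
proof -
  have "homotopy_class X Y g = class_comp X Y (homotopy_class Y Y t) (homotopy_class X Y f) \<longleftrightarrow>
      homotopic_maps X Y g (t \<circ> f)" if "continuous_map Y Y t" for t
    using class_comp_homotopy_class[OF f that]
      homotopy_class_eq_iff[OF continuous_map_compose[OF f that]] by simp
  then show ?thesis
    using f g by (auto simp: le_L_def homotopy_set_def)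
qed

lemma le_LR_iff:
  "(homotopy_class X Y g, homotopy_class X Y f) \<in> le_LR X Y \<longleftrightarrow>
    (\<exists>s t. continuous_map X X s \<and> continuous_map Y Y t \<and> homotopic_maps X Y g (t \<circ> f \<circ> s))"
proof -
  have "homotopy_class X Y g = class_comp X Y
        (class_comp X Y (homotopy_class Y Y t) (homotopy_class X Y f)) (homotopy_class X X s) \<longleftrightarrow>
      homotopic_maps X Y g (t \<circ> f \<circ> s)"
    if s: "continuous_map X X s" and t: "continuous_map Y Y t" for s t
  proof -
    have tf: "continuous_map X Y (t \<circ> f)" by (rule continuous_map_compose[OF f t])
    show ?thesis
      using class_comp_homotopy_class[OF f t] class_comp_homotopy_class[OF s tf]
        homotopy_class_eq_iff[OF continuous_map_compose[OF s tf]] by simp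
  qed
  moreover have "(homotopy_class X Y g, homotopy_class X Y f) \<in> le_LR X Y \<longleftrightarrow>
      (\<exists>s t. continuous_map X X s \<and> continuous_map Y Y t \<and> homotopy_class X Y g = class_comp X Y
        (class_comp X Y (homotopy_class Y Y t) (homotopy_class X Y f)) (homotopy_class X X s))"
    using f g by (auto simp: le_LR_def homotopy_set_def)
  ultimately show ?thesis by metis
qed

end

lemma preorder_on_homotopy_setI:
  assumes sub: "r \<subseteq> homotopy_set X Y \<times> homotopy_set X Y"
    and refl: "\<And>f. continuous_map X Y f \<Longrightarrow> (homotopy_class X Y f, homotopy_class X Y f) \<in> r"
    and trans: "\<And>f g h. \<lbrakk>continuous_map X Y f; continuous_map X Y g; continuous_map X Y h;
      (homotopy_class X Y f, homotopy_class X Y g) \<in> r;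
      (homotopy_class X Y g, homotopy_class X Y h) \<in> r\<rbrakk>
      \<Longrightarrow> (homotopy_class X Y f, homotopy_class X Y h) \<in> r"
  shows "preorder_on (homotopy_set X Y) r"
proof -
  have "refl_on (homotopy_set X Y) r"
    using refl by (auto simp: refl_on_def elim: homotopy_setE)
  moreover have "trans r"
  proof (rule transI)
    fix F G H assume FG: "(F, G) \<in> r" and GH: "(G, H) \<in> r"
    then have "F \<in> homotopy_set X Y" "G \<in> homotopy_set X Y" "H \<in> homotopy_set X Y"
      using sub by auto
    then show "(F, H) \<in> r"
      using FG GH by (elim homotopy_setE) (auto intro: trans)
  qed
  ultimately show ?thesis using sub by (simp add: preorder_on_def)
qed

lemma preorder_on_le_R: "preorder_on (homotopy_set X Y) (le_R X Y)"
proof (rule preorder_on_homotopy_setI)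
  show "le_R X Y \<subseteq> homotopy_set X Y \<times> homotopy_set X Y" by (auto simp: le_R_def)
next
  fix f assume f: "continuous_map X Y f"
  then show "(homotopy_class X Y f, homotopy_class X Y f) \<in> le_R X Y"
    by (auto simp: le_R_iff intro!: exI[of _ id])
next
  fix f g h
  assume f: "continuous_map X Y f" and g: "continuous_map X Y g" and h: "continuous_map X Y h"
    and "(homotopy_class X Y f, homotopy_class X Y g) \<in> le_R X Y"
    and "(homotopy_class X Y g, homotopy_class X Y h) \<in> le_R X Y"
  then obtain s s' where s: "continuous_map X X s" and fs: "homotopic_maps X Y f (g \<circ> s)"
    and s': "continuous_map X X s'" and gs: "homotopic_maps X Y g (h \<circ> s')"
    by (auto simp: le_R_iff)
  have "homotopic_maps X Y (g \<circ> s) ((h \<circ> s') \<circ> s)"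
    by (rule homotopic_with_compose_continuous_map_right[OF gs s]) auto
  then have "homotopic_maps X Y f (h \<circ> (s' \<circ> s))"
    using homotopic_with_trans[OF fs] by (simp add: o_assoc)
  then show "(homotopy_class X Y f, homotopy_class X Y h) \<in> le_R X Y"
    unfolding le_R_iff[OF h f] using continuous_map_compose[OF s s'] by blast
qed

lemma preorder_on_le_L: "preorder_on (homotopy_set X Y) (le_L X Y)"
proof (rule preorder_on_homotopy_setI)
  show "le_L X Y \<subseteq> homotopy_set X Y \<times> homotopy_set X Y" by (auto simp: le_L_def)
next
  fix f assume f: "continuous_map X Y f"
  then show "(homotopy_class X Y f, homotopy_class X Y f) \<in> le_L X Y"
    by (auto simp: le_L_iff intro!: exI[of _ id])
next
  fix f g h
  assume f: "continuous_map X Y f" and g: "continuous_map X Y g" and h: "continuous_map X Y h"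
    and "(homotopy_class X Y f, homotopy_class X Y g) \<in> le_L X Y"
    and "(homotopy_class X Y g, homotopy_class X Y h) \<in> le_L X Y"
  then obtain t t' where t: "continuous_map Y Y t" and ft: "homotopic_maps X Y f (t \<circ> g)"
    and t': "continuous_map Y Y t'" and gt: "homotopic_maps X Y g (t' \<circ> h)"
    by (auto simp: le_L_iff)
  have "homotopic_maps X Y (t \<circ> g) (t \<circ> (t' \<circ> h))"
    by (rule homotopic_with_compose_continuous_map_left[OF gt t]) auto
  then have "homotopic_maps X Y f ((t \<circ> t') \<circ> h)"
    using homotopic_with_trans[OF ft] by (simp add: o_assoc)
  then show "(homotopy_class X Y f, homotopy_class X Y h) \<in> le_L X Y"
    unfolding le_L_iff[OF h f] using continuous_map_compose[OF t' t] by blast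
qed

lemma preorder_on_le_LR: "preorder_on (homotopy_set X Y) (le_LR X Y)"
proof (rule preorder_on_homotopy_setI)
  show "le_LR X Y \<subseteq> homotopy_set X Y \<times> homotopy_set X Y" by (auto simp: le_LR_def)
next
  fix f assume f: "continuous_map X Y f"
  then show "(homotopy_class X Y f, homotopy_class X Y f) \<in> le_LR X Y"
    by (auto simp: le_LR_iff intro!: exI[of _ id])
next
  fix f g h
  assume f: "continuous_map X Y f" and g: "continuous_map X Y g" and h: "continuous_map X Y h"
    and "(homotopy_class X Y f, homotopy_class X Y g) \<in> le_LR X Y"
    and "(homotopy_class X Y g, homotopy_class X Y h) \<in> le_LR X Y"
  then obtain s t s' t' where s: "continuous_map X X s" and t: "continuous_map Y Y t"
    and fst: "homotopic_maps X Y f (t \<circ> g \<circ> s)"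
    and s': "continuous_map X X s'" and t': "continuous_map Y Y t'"
    and gst: "homotopic_maps X Y g (t' \<circ> h \<circ> s')"
    by (auto simp: le_LR_iff)
  have "homotopic_maps X Y (t \<circ> g) (t \<circ> (t' \<circ> h \<circ> s'))"
    by (rule homotopic_with_compose_continuous_map_left[OF gst t]) auto
  then have "homotopic_maps X Y (t \<circ> g \<circ> s) (t \<circ> (t' \<circ> h \<circ> s') \<circ> s)"
    by (rule homotopic_with_compose_continuous_map_right[OF _ s]) auto
  then have "homotopic_maps X Y f ((t \<circ> t') \<circ> h \<circ> (s' \<circ> s))"
    using homotopic_with_trans[OF fst] by (simp add: o_assoc)
  then show "(homotopy_class X Y f, homotopy_class X Y h) \<in> le_LR X Y"
    unfolding le_LR_iff[OF h f]
    using continuous_map_compose[OF s s'] continuous_map_compose[OF t' t] by blast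
qed

lemma le_R_subset_le_LR: "le_R X Y \<subseteq> le_LR X Y"
proof (clarify)
  fix G F assume GF: "(G, F) \<in> le_R X Y"
  then have "G \<in> homotopy_set X Y" "F \<in> homotopy_set X Y" by (auto simp: le_R_def)
  then obtain f g where f: "continuous_map X Y f" and F: "F = homotopy_class X Y f"
    and g: "continuous_map X Y g" and G: "G = homotopy_class X Y g"
    by (metis homotopy_setE)
  then obtain s where "continuous_map X X s" "homotopic_maps X Y g (id \<circ> f \<circ> s)"
    using GF by (auto simp: le_R_iff)
  then show "(G, F) \<in> le_LR X Y"
    unfolding F G le_LR_iff[OF f g] using continuous_map_id by blast
qed

lemma le_L_subset_le_LR: "le_L X Y \<subseteq> le_LR X Y"
proof (clarify)
  fix G F assume GF: "(G, F) \<in> le_L X Y"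
  then have "G \<in> homotopy_set X Y" "F \<in> homotopy_set X Y" by (auto simp: le_L_def)
  then obtain f g where f: "continuous_map X Y f" and F: "F = homotopy_class X Y f"
    and g: "continuous_map X Y g" and G: "G = homotopy_class X Y g"
    by (metis homotopy_setE)
  then obtain t where "continuous_map Y Y t" "homotopic_maps X Y g (t \<circ> f \<circ> id)"
    using GF by (auto simp: le_L_iff)
  then show "(G, F) \<in> le_LR X Y"
    unfolding F G le_LR_iff[OF f g] using continuous_map_id by blast
qed

text \<open>The two-sided preorder contains the one-sided ones, so monotonicity for it is enough.\<close>

lemma cat_class_mono:
  assumes "(G, F) \<in> le_LR X Y"
  shows "cat_class X Y G \<le> cat_class X Y F"
proof -
  have "G \<in> homotopy_set X Y" "F \<in> homotopy_set X Y" using assms by (auto simp: le_LR_def)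
  then obtain f g where f: "continuous_map X Y f" and F: "F = homotopy_class X Y f"
    and g: "continuous_map X Y g" and G: "G = homotopy_class X Y g"
    by (metis homotopy_setE)
  obtain s t where s: "continuous_map X X s" and t: "continuous_map Y Y t"
    and gst: "homotopic_maps X Y g (t \<circ> f \<circ> s)"
    using assms f g by (auto simp: F G le_LR_iff)
  have "ls_cat X Y g = ls_cat X Y (t \<circ> f \<circ> s)" by (rule ls_cat_homotopic[OF gst])
  also have "\<dots> \<le> ls_cat X Y (t \<circ> f)"
    by (rule ls_cat_compose_le(2)[OF s continuous_map_compose[OF f t]])
  also have "\<dots> \<le> ls_cat X Y f" by (rule ls_cat_compose_le(1)[OF f t])
  finally show ?thesis by (simp add: F G f g cat_class_homotopy_class)
qed

lemma cat_class_in_cat_values: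
  assumes "F \<in> homotopy_set X Y"
  shows "cat_class X Y F \<in> cat_values X Y"
  using assms by (elim homotopy_setE) (auto simp: cat_class_homotopy_class cat_values_def)

lemma order_preserving_cat_class:
  assumes "r \<subseteq> le_LR X Y"
  shows "order_preserving (homotopy_set X Y) r (cat_values X Y) (le_on (cat_values X Y))
    (cat_class X Y)"
  using assms
  by (auto simp: order_preserving_def monotone_on_def le_on_def cat_class_in_cat_values
      cat_class_mono subset_iff)

section \<open>The category as a stratification of the homotopy set\<close>


theorem mainTheorem8:
  fixes X :: "'a topology" and Y :: "'b topology"
  shows
    "(\<forall>f. continuous_map X Y f \<longrightarrow>
        cat_class X Y (homotopy_class X Y f) = ls_cat X Y f) \<and>
     (\<forall>r\<in>{le_R X Y, le_L X Y, le_LR X Y}.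
        order_preserving (homotopy_set X Y) r (cat_values X Y) (le_on (cat_values X Y)) (cat_class X Y)) \<and>
     (\<forall>f g. continuous_map X Y f \<and> continuous_map X Y g \<longrightarrow>
        ((homotopy_class X Y g, homotopy_class X Y f) \<in> le_R X Y \<longleftrightarrow>
          (\<exists>s. continuous_map X X s \<and> homotopic_maps X Y g (f \<circ> s)))) \<and>
     (\<forall>f g s. continuous_map X Y f \<and> continuous_map X Y g \<and> continuous_map X X s \<and>
          homotopic_maps X Y g (f \<circ> s) \<longrightarrow>
        ls_cat X Y g = ls_cat X Y (f \<circ> s) \<and>
        ls_cat X Y (f \<circ> s) \<le> min (ls_cat X Y f) (ls_cat X X s) \<and>
        min (ls_cat X Y f) (ls_cat X X s) \<le> ls_cat X Y f) \<and>
     (\<forall>f g. continuous_map X Y f \<and> continuous_map X Y g \<and>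
          (homotopy_class X Y g, homotopy_class X Y f) \<in> le_R X Y \<longrightarrow>
        ls_cat X Y g \<le> ls_cat X Y f) \<and>
     (poset_map
        (homotopy_set X Y // equiv_of (le_R X Y)) (quot_order (homotopy_set X Y) (le_R X Y))
        (cat_values X Y) (le_on (cat_values X Y)) (cat_quot X Y)) \<and>
     (\<forall>f. continuous_map X Y f \<longrightarrow>
        cat_quot X Y (quot_class (le_R X Y) (homotopy_class X Y f)) = ls_cat X Y f) \<and>
     (\<forall>f g. continuous_map X Y f \<and> continuous_map X Y g \<longrightarrow>
        ((homotopy_class X Y g, homotopy_class X Y f) \<in> le_L X Y \<longleftrightarrow>
          (\<exists>t. continuous_map Y Y t \<and> homotopic_maps X Y g (t \<circ> f)))) \<and>
     (\<forall>f g t. continuous_map X Y f \<and> continuous_map X Y g \<and> continuous_map Y Y t \<and>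
          homotopic_maps X Y g (t \<circ> f) \<longrightarrow>
        ls_cat X Y g = ls_cat X Y (t \<circ> f) \<and>
        ls_cat X Y (t \<circ> f) \<le> min (ls_cat Y Y t) (ls_cat X Y f) \<and>
        min (ls_cat Y Y t) (ls_cat X Y f) \<le> ls_cat X Y f) \<and>
     (\<forall>f g. continuous_map X Y f \<and> continuous_map X Y g \<and>
          (homotopy_class X Y g, homotopy_class X Y f) \<in> le_L X Y \<longrightarrow>
        ls_cat X Y g \<le> ls_cat X Y f) \<and>
     (poset_map
        (homotopy_set X Y // equiv_of (le_L X Y)) (quot_order (homotopy_set X Y) (le_L X Y))
        (cat_values X Y) (le_on (cat_values X Y)) (cat_quot X Y)) \<and>
     (\<forall>f. continuous_map X Y f \<longrightarrow>
        cat_quot X Y (quot_class (le_L X Y) (homotopy_class X Y f)) = ls_cat X Y f) \<and>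
     (\<forall>f g. continuous_map X Y f \<and> continuous_map X Y g \<longrightarrow>
        ((homotopy_class X Y g, homotopy_class X Y f) \<in> le_LR X Y \<longleftrightarrow>
          (\<exists>s t. continuous_map X X s \<and> continuous_map Y Y t \<and>
            homotopic_maps X Y g (t \<circ> f \<circ> s)))) \<and>
     (\<forall>f g s t. continuous_map X Y f \<and> continuous_map X Y g \<and>
          continuous_map X X s \<and> continuous_map Y Y t \<and> homotopic_maps X Y g (t \<circ> f \<circ> s) \<longrightarrow>
        ls_cat X Y g = ls_cat X Y (t \<circ> f \<circ> s) \<and>
        ls_cat X Y (t \<circ> f \<circ> s) \<le> Min {ls_cat Y Y t, ls_cat X Y f, ls_cat X X s} \<and>
        Min {ls_cat Y Y t, ls_cat X Y f, ls_cat X X s} \<le> ls_cat X Y f) \<and>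
     (\<forall>f g. continuous_map X Y f \<and> continuous_map X Y g \<and>
          (homotopy_class X Y g, homotopy_class X Y f) \<in> le_LR X Y \<longrightarrow>
        ls_cat X Y g \<le> ls_cat X Y f) \<and>
     (poset_map
        (homotopy_set X Y // equiv_of (le_LR X Y)) (quot_order (homotopy_set X Y) (le_LR X Y))
        (cat_values X Y) (le_on (cat_values X Y)) (cat_quot X Y)) \<and>
     (\<forall>f. continuous_map X Y f \<longrightarrow>
        cat_quot X Y (quot_class (le_LR X Y) (homotopy_class X Y f)) = ls_cat X Y f) \<and>
     (\<forall>r\<in>{le_R X Y, le_L X Y, le_LR X Y}.
        finer_stratification (alexandroff (homotopy_set X Y) r)
          (homotopy_set X Y // equiv_of r) (quot_order (homotopy_set X Y) r) (quot_class r)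
          (cat_values X Y) (le_on (cat_values X Y)) (cat_class X Y) (cat_quot X Y)) \<and>
     (\<forall>r\<in>{le_R X Y, le_L X Y, le_LR X Y}.
        finer_stratification (alexandroff (homotopy_set X Y) (r\<inverse>))
          (homotopy_set X Y // equiv_of r) ((quot_order (homotopy_set X Y) r)\<inverse>) (quot_class r)
          (cat_values X Y) ((le_on (cat_values X Y))\<inverse>) (cat_class X Y) (cat_quot X Y)) \<and>
     (\<forall>r\<in>{le_R X Y, le_L X Y, le_LR X Y}.
        poset_stratified (alexandroff (homotopy_set X Y // equiv_of r) (quot_order (homotopy_set X Y) r))
          (cat_values X Y) (le_on (cat_values X Y)) (cat_quot X Y) \<and>
        poset_stratified
          (alexandroff (homotopy_set X Y // equiv_of r) ((quot_order (homotopy_set X Y) r)\<inverse>))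
          (cat_values X Y) ((le_on (cat_values X Y))\<inverse>) (cat_quot X Y)) \<and>
     (\<forall>r\<in>{le_R X Y, le_L X Y, le_LR X Y}. \<forall>F\<in>homotopy_set X Y.
        (cat_quot X Y \<circ> quot_class r) F = cat_class X Y F)"
proof -
  let ?H = "homotopy_set X Y" and ?V = "cat_values X Y"
  let ?rels = "{le_R X Y, le_L X Y, le_LR X Y}"
  have pre: "preorder_on ?H r" if "r \<in> ?rels" for r
    using that by (auto simp: preorder_on_le_R preorder_on_le_L preorder_on_le_LR)
  have sub: "r \<subseteq> le_LR X Y" if "r \<in> ?rels" for r
    using that le_R_subset_le_LR[of X Y] le_L_subset_le_LR[of X Y] by blast
  have po: "partial_order_on ?V (le_on ?V)" by (rule partial_order_on_le_on)
  have po': "partial_order_on ?V ((le_on ?V)\<inverse>)" using po by simp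
  have quot: "cat_quot X Y = (\<lambda>C. the_elem (cat_class X Y ` C))"
    by (simp add: cat_quot_def fun_eq_iff)
  have op: "order_preserving ?H r ?V (le_on ?V) (cat_class X Y)" if "r \<in> ?rels" for r
    by (rule order_preserving_cat_class[OF sub[OF that]])
  have pre': "preorder_on ?H (r\<inverse>)" if "r \<in> ?rels" for r
    using pre[OF that] by simp
  have val: "cat_quot X Y (quot_class r F) = cat_class X Y F" if "r \<in> ?rels" "F \<in> ?H" for r F
    unfolding quot using po by (intro the_elem_quot_class[OF pre[OF that(1)] _ op[OF that(1)] that(2)])
      (simp add: partial_order_on_def)
  have val': "cat_quot X Y (quot_class r (homotopy_class X Y f)) = ls_cat X Y f"
    if "r \<in> ?rels" "continuous_map X Y f" for r f
    using val[OF that(1) homotopy_class_in_homotopy_set[OF that(2)]] that(2)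
    by (simp add: cat_class_homotopy_class)
  have pm: "poset_map (?H // equiv_of r) (quot_order ?H r) ?V (le_on ?V) (cat_quot X Y)"
    if "r \<in> ?rels" for r
    unfolding quot by (rule poset_map_quot[OF pre[OF that] po op[OF that]])
  have fs: "finer_stratification (alexandroff ?H r) (?H // equiv_of r) (quot_order ?H r)
      (quot_class r) ?V (le_on ?V) (cat_class X Y) (cat_quot X Y)" if "r \<in> ?rels" for r
    unfolding quot by (rule finer_stratification_quot[OF pre[OF that] po op[OF that]])
  have fs': "finer_stratification (alexandroff ?H (r\<inverse>)) (?H // equiv_of r) ((quot_order ?H r)\<inverse>)
      (quot_class r) ?V ((le_on ?V)\<inverse>) (cat_class X Y) (cat_quot X Y)" if "r \<in> ?rels" for r
    unfolding quot
    using finer_stratification_quot[OF pre'[OF that] po' order_preserving_converse[OF op[OF that]]]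
    by (simp add: quot_order_converse)
  have opq: "order_preserving (?H // equiv_of r) (quot_order ?H r) ?V (le_on ?V) (cat_quot X Y)"
    if "r \<in> ?rels" for r
    using pm[OF that] by (simp add: poset_map_def)
  have strat: "poset_stratified (alexandroff (?H // equiv_of r) (quot_order ?H r)) ?V (le_on ?V)
        (cat_quot X Y) \<and>
      poset_stratified (alexandroff (?H // equiv_of r) ((quot_order ?H r)\<inverse>)) ?V ((le_on ?V)\<inverse>)
        (cat_quot X Y)" if "r \<in> ?rels" for r
    using poset_stratified_alexandroff[OF opq[OF that] po]
      poset_stratified_alexandroff[OF order_preserving_converse[OF opq[OF that]] po'] by blast
  have mono: "ls_cat X Y g \<le> ls_cat X Y f"
    if "r \<in> ?rels" "continuous_map X Y f" "continuous_map X Y g"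
      "(homotopy_class X Y g, homotopy_class X Y f) \<in> r" for r f g
    using cat_class_mono[of "homotopy_class X Y g" "homotopy_class X Y f" X Y] that sub[OF that(1)]
    by (auto simp: cat_class_homotopy_class)
  have R: "ls_cat X Y g = ls_cat X Y (f \<circ> s) \<and>
      ls_cat X Y (f \<circ> s) \<le> min (ls_cat X Y f) (ls_cat X X s) \<and>
      min (ls_cat X Y f) (ls_cat X X s) \<le> ls_cat X Y f"
    if "continuous_map X Y f" "continuous_map X X s" "homotopic_maps X Y g (f \<circ> s)" for f g s
    using ls_cat_homotopic[OF that(3)] ls_cat_compose_le[OF that(2,1)] by simp
  have L: "ls_cat X Y g = ls_cat X Y (t \<circ> f) \<and>
      ls_cat X Y (t \<circ> f) \<le> min (ls_cat Y Y t) (ls_cat X Y f) \<and>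
      min (ls_cat Y Y t) (ls_cat X Y f) \<le> ls_cat X Y f"
    if "continuous_map X Y f" "continuous_map Y Y t" "homotopic_maps X Y g (t \<circ> f)" for f g t
    using ls_cat_homotopic[OF that(3)] ls_cat_compose_le[OF that(1,2)] by simp
  have LR: "ls_cat X Y g = ls_cat X Y (t \<circ> f \<circ> s) \<and>
      ls_cat X Y (t \<circ> f \<circ> s) \<le> Min {ls_cat Y Y t, ls_cat X Y f, ls_cat X X s} \<and>
      Min {ls_cat Y Y t, ls_cat X Y f, ls_cat X X s} \<le> ls_cat X Y f"
    if "continuous_map X Y f" "continuous_map X X s" "continuous_map Y Y t"
      "homotopic_maps X Y g (t \<circ> f \<circ> s)" for f g s t
    using ls_cat_homotopic[OF that(4)] ls_cat_compose_le[OF that(1,3)]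
      ls_cat_compose_le[OF that(2) continuous_map_compose[OF that(1,3)]]
    by (auto simp: min_le_iff_disj)
  note rels = insertI1 insertI2[OF insertI1] insertI2[OF insertI2[OF insertI1]]
  show ?thesis
    apply (intro conjI)
    subgoal by (simp add: cat_class_homotopy_class)
    subgoal using op by blast
    subgoal by (simp add: le_R_iff)
    subgoal using R by blast
    subgoal using mono[OF rels(1)] by blast
    subgoal by (rule pm) simp
    subgoal by (simp add: val')
    subgoal by (simp add: le_L_iff)
    subgoal using L by blast
    subgoal using mono[OF rels(2)] by blast
    subgoal by (rule pm) simp
    subgoal by (simp add: val')
    subgoal by (simp add: le_LR_iff)
    subgoal using LR by blast
    subgoal using mono[OF rels(3)] by blast
    subgoal by (rule pm) simp
    subgoal by (simp add: val')
    subgoal using fs by blast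
    subgoal using fs' by blast
    subgoal using strat by blast
    subgoal using val by simp
    done
qed

end
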